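(* The Middle-point Mechanism (Mid-M) is strategyproof, and has an approximation ratio of $\frac{29+20\sqrt{10}}{54}$ for minimizing the maximum cost, when locations are public and group memberships are private; that is, it is strategyproof in that setting and for every profile $\mathbf r$ its output $y$ satisfies $\mathrm{MC}(y,\mathbf r)\le \frac{29+20\sqrt{10}}{54}\min_{z\in[0,1]}\mathrm{MC}(z,\mathbf r)$.
   Context: Setting. $N=\{1,\dots,n\}$ is a set of agents, $I=[0,1]$, $[m]=\{1,\dots,m\}$ indexes groups. Agent $i$ has a profile $r_i=(x_i,g_i)$ with location $x_i\in I$ and group $g_i\in[m]$; $\mathbf r=(r_1,\dots,r_n)$. $G_j=\{i\in N: g_i=j\}$. $d(a,b)=|a-b|$. Each group $j$ has a known externality factor $\alpha_j\ge 0$. If the facility is at $y\in I$, the cost of agent $i$ is $$c_i(y,\mathbf r)=d(y,x_i)+\alpha_{g_i}\sum_{k\in G_{g_i}\setminus\{i\}}(1-d(y,x_k)).$$ Standing assumption on (true) profiles: $\alpha_j\le 1/(|G_j|-1)$ for each group $j$ (void if $|G_j|\le 1$). Maximum cost: $\mathrm{MC}(y,\mathbf r)=\max_{i\in N}c_i(y,\mathbf r)$. A (deterministic) mechanism $f$ maps a profile to a facility location in $I$. Strategyproof when locations are public and group memberships are private: for every true profile $\mathbf r$, every reported profile $\mathbf r'$ with the same locations ($x'_k=x_k$ for all $k$) and every agent $i$, $c_i(f(r_i,\mathbf r'_{-i}),\mathbf r)\le c_i(f(\mathbf r'),\mathbf r)$, where $\mathbf r'_{-i}$ are the reports of all agents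 other than $i$. Mid-M: output $y=\frac12\left(\min_{i\in N}x_i+\max_{i\in N}x_i\right)$. *)

theory Defs
  imports "HOL-Analysis.Analysis"
begin

text \<open>
  Agents are \<open>{1..n}\<close> and groups are \<open>{1..m}\<close>. A profile assigns to every agent a
  location in \<open>[0,1]\<close> and a group. Profiles are extensional functions, so that a mechanism
  sees the reports of the \<open>n\<close> agents and nothing else.
\<close>

type_synonym profile = "nat \<Rightarrow> real \<times> nat"

definition profiles :: "nat \<Rightarrow> nat \<Rightarrow> profile set" where
  "profiles n m = {1..n} \<rightarrow>\<^sub>E ({0..1} \<times> {1..m})"

abbreviation loc :: "profile \<Rightarrow> nat \<Rightarrow> real" where
  "loc r i \<equiv> fst (r i)"

abbreviation grp :: "profile \<Rightarrow> nat \<Rightarrow> nat" where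
  "grp r i \<equiv> snd (r i)"

definition members :: "nat \<Rightarrow> profile \<Rightarrow> nat \<Rightarrow> nat set" where
  "members n r j = {i \<in> {1..n}. grp r i = j}"

definition cost :: "nat \<Rightarrow> (nat \<Rightarrow> real) \<Rightarrow> nat \<Rightarrow> real \<Rightarrow> profile \<Rightarrow> real" where
  "cost n \<alpha> i y r =
     dist y (loc r i) + \<alpha> (grp r i) * (\<Sum>k \<in> members n r (grp r i) - {i}. 1 - dist y (loc r k))"

definition max_cost :: "nat \<Rightarrow> (nat \<Rightarrow> real) \<Rightarrow> real \<Rightarrow> profile \<Rightarrow> real" where
  "max_cost n \<alpha> y r = (MAX i\<in>{1..n}. cost n \<alpha> i y r)"

text \<open>The infimum is a minimum: see \<open>opt_max_cost_attained\<close> below.\<close>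

definition opt_max_cost :: "nat \<Rightarrow> (nat \<Rightarrow> real) \<Rightarrow> profile \<Rightarrow> real" where
  "opt_max_cost n \<alpha> r = (INF z\<in>{0..1}. max_cost n \<alpha> z r)"

text \<open>
  The standing bound on the externality factors is imposed on true profiles only; an agent may
  misreport so that the reported groups violate it.
\<close>

definition true_profiles :: "nat \<Rightarrow> nat \<Rightarrow> (nat \<Rightarrow> real) \<Rightarrow> profile set" where
  "true_profiles n m \<alpha> =
     {r \<in> profiles n m. \<forall>j\<in>{1..m}.
        card (members n r j) \<ge> 2 \<longrightarrow> \<alpha> j \<le> 1 / (real (card (members n r j)) - 1)}"

definition mechanism :: "nat \<Rightarrow> nat \<Rightarrow> (profile \<Rightarrow> real) \<Rightarrow> bool" where
  "mechanism n m f \<longleftrightarrow> f \<in> profiles n m \<rightarrow> {0..1}"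

text \<open>
  Locations are public, so the reported profile \<open>r'\<close> has the true locations; memberships are
  private, so the groups in \<open>r'\<close> are arbitrary. Costs are always those of the true profile \<open>r\<close>.
\<close>

definition strategyproof_private_groups ::
    "nat \<Rightarrow> nat \<Rightarrow> (nat \<Rightarrow> real) \<Rightarrow> (profile \<Rightarrow> real) \<Rightarrow> bool" where
  "strategyproof_private_groups n m \<alpha> f \<longleftrightarrow>
     (\<forall>r\<in>true_profiles n m \<alpha>. \<forall>r'\<in>profiles n m.
        (\<forall>k\<in>{1..n}. loc r' k = loc r k) \<longrightarrow>
        (\<forall>i\<in>{1..n}. cost n \<alpha> i (f (r'(i := r i))) r \<le> cost n \<alpha> i (f r') r))"

definition approximates_max_cost ::
    "nat \<Rightarrow> nat \<Rightarrow> (nat \<Rightarrow> real) \<Rightarrow> real \<Rightarrow> (profile \<Rightarrow> real) \<Rightarrow> bool" where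
  "approximates_max_cost n m \<alpha> \<rho> f \<longleftrightarrow>
     (\<forall>r\<in>true_profiles n m \<alpha>. max_cost n \<alpha> (f r) r \<le> \<rho> * opt_max_cost n \<alpha> r)"

definition mid_M :: "nat \<Rightarrow> profile \<Rightarrow> real" where
  "mid_M n r = 1/2 * ((MIN i\<in>{1..n}. loc r i) + (MAX i\<in>{1..n}. loc r i))"

lemma continuous_on_Max_image:
  fixes h :: "'i \<Rightarrow> 'b::topological_space \<Rightarrow> real"
  assumes "finite A" "A \<noteq> {}" "\<And>i. i \<in> A \<Longrightarrow> continuous_on S (h i)"
  shows "continuous_on S (\<lambda>z. MAX i\<in>A. h i z)"
  using assms
proof (induction A rule: finite_ne_induct)
  case (singleton x)
  then show ?case by simp
next
  case (insert x F)
  have "(\<lambda>z. MAX i\<in>insert x F. h i z) = (\<lambda>z. max (h x z) (MAX i\<in>F. h i z))"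
    using insert.hyps by simp
  then show ?case
    using insert by (simp add: continuous_on_max)
qed

lemma continuous_on_cost: "continuous_on S (\<lambda>z. cost n \<alpha> i z r)"
  unfolding cost_def by (intro continuous_intros)

lemma opt_max_cost_attained:
  assumes "1 \<le> n"
  obtains z where "z \<in> {0..1}" "opt_max_cost n \<alpha> r = max_cost n \<alpha> z r"
    "\<And>y. y \<in> {0..1} \<Longrightarrow> max_cost n \<alpha> z r \<le> max_cost n \<alpha> y r"
proof -
  have "continuous_on {0..1} (\<lambda>z. max_cost n \<alpha> z r)"
    unfolding max_cost_def
    by (rule continuous_on_Max_image) (use assms in \<open>simp_all add: continuous_on_cost\<close>)
  then have "\<exists>z\<in>{0..1}. \<forall>y\<in>{0..1}. max_cost n \<alpha> z r \<le> max_cost n \<alpha> y r"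
    by (intro continuous_attains_inf) simp_all
  then obtain z where z: "z \<in> {0..1}"
    "\<And>y. y \<in> {0..1} \<Longrightarrow> max_cost n \<alpha> z r \<le> max_cost n \<alpha> y r"
    by blast
  have "opt_max_cost n \<alpha> r = max_cost n \<alpha> z r"
    unfolding opt_max_cost_def
  proof (rule cInf_eq_minimum)
    show "max_cost n \<alpha> z r \<in> (\<lambda>z. max_cost n \<alpha> z r) ` {0..1}"
      using z(1) by (rule imageI)
  next
    fix v assume "v \<in> (\<lambda>z. max_cost n \<alpha> z r) ` {0..1}"
    then show "max_cost n \<alpha> z r \<le> v"
      using z(2) by blast
  qed
  with z that show thesis by blast
qed

end

theory Submission
  imports Defs
begin

text \<open>
  Mid-M ignores the groups, so misreporting a group has no effect.

  For the ratio, let \<open>h\<close> be half the distance between the extreme agents, \<open>z\<close> any location,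
  \<open>t = |z - y|\<close>, \<open>O = MC(z)\<close>, and \<open>c\<close> the cost at \<open>y\<close> of an agent of a group \<open>G\<close> with factor
  \<open>\<alpha>\<close>. Put \<open>A = \<alpha> (|G| - 1)\<close>, so \<open>0 \<le> A \<le> 1\<close>. The extreme agents give \<open>h + t \<le> O\<close>; moving
  the facility from \<open>z\<close> to \<open>y\<close> gives \<open>c \<le> O + t (1 + A)\<close>; trivially \<open>c \<le> h + A\<close>; and averaging
  the costs at \<open>z\<close> over \<open>G\<close> gives \<open>A \<le> O\<close>. Adding \<open>1 + A\<close> times the third inequality to the
  second eliminates \<open>h\<close> and \<open>t\<close>: \<open>(2 + A) c \<le> (2 + A) O + A (1 + A)\<close>, whence
  \<open>c \<le> 5/3 O\<close>, which is even better than the claimed ratio.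
\<close>

section \<open>Profiles and the maximum cost\<close>

lemma finite_members [simp]: "finite (members n r j)"
  by (simp add: members_def)

lemma profiles_loc: "r \<in> profiles n m \<Longrightarrow> i \<in> {1..n} \<Longrightarrow> loc r i \<in> {0..1}"
  and profiles_grp: "r \<in> profiles n m \<Longrightarrow> i \<in> {1..n} \<Longrightarrow> grp r i \<in> {1..m}"
  by (auto simp: profiles_def PiE_iff mem_Times_iff)

lemma true_profiles_profiles: "r \<in> true_profiles n m \<alpha> \<Longrightarrow> r \<in> profiles n m"
  by (simp add: true_profiles_def)

lemma members_loc: "r \<in> profiles n m \<Longrightarrow> k \<in> members n r j \<Longrightarrow> loc r k \<in> {0..1}"
  using profiles_loc by (simp add: members_def)

lemma dist_unit_interval_le:
  fixes a b :: real
  shows "a \<in> {0..1} \<Longrightarrow> b \<in> {0..1} \<Longrightarrow> dist a b \<le> 1"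
  by (auto simp: dist_real_def)

lemma cost_le_max_cost: "i \<in> {1..n} \<Longrightarrow> cost n \<alpha> i z r \<le> max_cost n \<alpha> z r"
  unfolding max_cost_def by simp

lemma max_cost_le:
  assumes "1 \<le> n" "\<And>i. i \<in> {1..n} \<Longrightarrow> cost n \<alpha> i z r \<le> c"
  shows "max_cost n \<alpha> z r \<le> c"
  unfolding max_cost_def using assms by (subst Max_le_iff) auto

section \<open>Feasibility and strategyproofness of Mid-M\<close>

lemma mid_M_cong: "(\<And>k. k \<in> {1..n} \<Longrightarrow> loc r k = loc r' k) \<Longrightarrow> mid_M n r = mid_M n r'"
  unfolding mid_M_def by (simp cong: image_cong_simp)

lemma mid_M_bounds:
  assumes "1 \<le> n"
  obtains p q where "p \<in> {1..n}" "q \<in> {1..n}" "mid_M n r = (loc r p + loc r q) / 2"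
    "\<And>k. k \<in> {1..n} \<Longrightarrow> loc r p \<le> loc r k" "\<And>k. k \<in> {1..n} \<Longrightarrow> loc r k \<le> loc r q"
proof -
  let ?X = "(\<lambda>i. loc r i) ` {1..n}"
  have ne: "?X \<noteq> {}" using assms by simp
  have "Min ?X \<in> ?X" "Max ?X \<in> ?X"
    using Min_in[OF _ ne] Max_in[OF _ ne] by simp_all
  then obtain p q where pq: "p \<in> {1..n}" "q \<in> {1..n}" "Min ?X = loc r p" "Max ?X = loc r q"
    unfolding image_iff by blast
  show thesis
  proof
    show "mid_M n r = (loc r p + loc r q) / 2"
      by (simp add: mid_M_def flip: pq(3,4))
  next
    fix k assume "k \<in> {1..n}"
    then show "loc r p \<le> loc r k" "loc r k \<le> loc r q"
      by (simp_all flip: pq(3,4))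
  qed (fact pq)+
qed

lemma mechanism_mid_M:
  assumes "1 \<le> n"
  shows "mechanism n m (mid_M n)"
  unfolding mechanism_def
proof
  fix r assume r: "r \<in> profiles n m"
  obtain p q where "p \<in> {1..n}" "q \<in> {1..n}" "mid_M n r = (loc r p + loc r q) / 2"
    using mid_M_bounds[OF assms] by metis
  then show "mid_M n r \<in> {0..1}"
    using profiles_loc[OF r, of p] profiles_loc[OF r, of q] by simp
qed

lemma strategyproof_mid_M: "strategyproof_private_groups n m \<alpha> (mid_M n)"
  unfolding strategyproof_private_groups_def
proof (intro ballI impI)
  fix r r' i
  assume "\<forall>k\<in>{1..n}. loc r' k = loc r k" and "i \<in> {1..n}"
  \<comment> \<open>Since \<open>r'\<close> carries the true locations, replacing its entry at
    \<open>i\<close> by \<open>r i\<close> can change only the group.\<close>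
  then have "mid_M n (r'(i := r i)) = mid_M n r'"
    by (intro mid_M_cong) auto
  then show "cost n \<alpha> i (mid_M n (r'(i := r i))) r \<le> cost n \<alpha> i (mid_M n r') r"
    by simp
qed

section \<open>Bounds on costs at a fixed location\<close>

lemma dist_le_cost:
  assumes "r \<in> profiles n m" "z \<in> {0..1}" "0 \<le> \<alpha> (grp r i)"
  shows "dist z (loc r i) \<le> cost n \<alpha> i z r"
proof -
  have "0 \<le> (\<Sum>k \<in> members n r (grp r i) - {i}. 1 - dist z (loc r k))"
  proof (rule sum_nonneg)
    fix k assume "k \<in> members n r (grp r i) - {i}"
    then show "0 \<le> 1 - dist z (loc r k)"
      using dist_unit_interval_le[OF assms(2) members_loc[OF assms(1)]] by auto
  qed
  then show ?thesis
    using assms(3) by (simp add: cost_def)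
qed

lemma card_members_remove:
  assumes "i \<in> {1..n}"
  shows "real (card (members n r (grp r i) - {i})) = real (card (members n r (grp r i))) - 1"
proof -
  have i: "i \<in> members n r (grp r i)" using assms by (simp add: members_def)
  then have "0 < card (members n r (grp r i))" by (auto simp: card_gt_0_iff)
  with i show ?thesis by (simp add: card_Diff_singleton of_nat_diff)
qed

lemma cost_le_dist_plus:
  assumes "i \<in> {1..n}" "0 \<le> \<alpha> (grp r i)"
  shows "cost n \<alpha> i y r
    \<le> dist y (loc r i) + \<alpha> (grp r i) * (real (card (members n r (grp r i))) - 1)"
proof -
  have "(\<Sum>k \<in> members n r (grp r i) - {i}. 1 - dist y (loc r k))
      \<le> real (card (members n r (grp r i) - {i})) * 1"
    by (rule sum_bounded_above) simp
  then show ?thesis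
    using assms unfolding cost_def card_members_remove[OF assms(1)]
    by (intro add_left_mono mult_left_mono) simp_all
qed

text \<open>By the triangle inequality every distance changes by at most \<open>dist y z\<close>.
  The agent's own distance counts with weight 1, that of each other group member with weight
  \<open>\<alpha> (grp r i)\<close>.\<close>

lemma cost_move_le:
  assumes "i \<in> {1..n}" "0 \<le> \<alpha> (grp r i)"
  shows "cost n \<alpha> i y r \<le> cost n \<alpha> i z r
    + dist y z * (1 + \<alpha> (grp r i) * (real (card (members n r (grp r i))) - 1))"
proof -
  let ?M = "members n r (grp r i) - {i}"
  have tri: "dist y x \<le> dist y z + dist z x" "dist z x \<le> dist y z + dist y x" for x
    using dist_triangle[of y x z] dist_triangle[of z x y] by (simp_all add: dist_commute)
  have "(\<Sum>k\<in>?M. 1 - dist y (loc r k)) \<le> (\<Sum>k\<in>?M. (1 - dist z (loc r k)) + dist y z)"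
  proof (rule sum_mono)
    fix k
    show "1 - dist y (loc r k) \<le> (1 - dist z (loc r k)) + dist y z"
      using tri(2)[of "loc r k"] by linarith
  qed
  also have "\<dots> = (\<Sum>k\<in>?M. 1 - dist z (loc r k)) + real (card ?M) * dist y z"
    by (simp only: sum.distrib sum_constant)
  finally have "\<alpha> (grp r i) * (\<Sum>k\<in>?M. 1 - dist y (loc r k))
      \<le> \<alpha> (grp r i) * ((\<Sum>k\<in>?M. 1 - dist z (loc r k)) + real (card ?M) * dist y z)"
    using assms(2) by (rule mult_left_mono)
  then show ?thesis
    using tri(1)[of "loc r i"] unfolding cost_def card_members_remove[OF assms(1)]
    by (simp add: algebra_simps)
qed

text \<open>
  With \<open>D\<close> the average distance from \<open>z\<close> to the group and \<open>A\<close> the left-hand side below, the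
  average cost of the group at \<open>z\<close> is \<open>D + A (1 - D) \<ge> A\<close>.
\<close>

lemma externality_le_max_cost:
  assumes i: "i \<in> {1..n}" and A1: "\<alpha> (grp r i) * (real (card (members n r (grp r i))) - 1) \<le> 1"
  shows "\<alpha> (grp r i) * (real (card (members n r (grp r i))) - 1) \<le> max_cost n \<alpha> z r"
proof -
  define G where "G = members n r (grp r i)"
  define a where "a = \<alpha> (grp r i)"
  define s where "s = real (card G)"
  define S where "S = (\<Sum>k\<in>G. dist z (loc r k))"
  have fin: "finite G" and iG: "i \<in> G"
    using i by (auto simp: G_def members_def)
  then have s: "0 < s" by (auto simp: s_def card_gt_0_iff)
  have total: "(\<Sum>l\<in>G. 1 - dist z (loc r l)) = s - S"
    by (simp add: sum_subtractf s_def S_def)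
  \<comment> \<open>The sum over the others is the total over \<open>G\<close> minus the agent's own
    term, so each cost is affine in the agent's own distance and can be summed.\<close>
  have cost_G: "cost n \<alpha> k z r = dist z (loc r k) + a * (s - S - (1 - dist z (loc r k)))"
    if "k \<in> G" for k
  proof -
    have "grp r k = grp r i" using that by (simp add: G_def members_def)
    then show ?thesis
      using total that fin by (simp add: cost_def a_def sum_diff1 flip: G_def)
  qed
  have "(\<Sum>k\<in>G. cost n \<alpha> k z r)
      = (\<Sum>k\<in>G. dist z (loc r k) + a * (s - S - (1 - dist z (loc r k))))"
    using cost_G by (rule sum.cong[OF refl])
  also have "\<dots> = S + a * (s * (s - S) - (s - S))"
    by (simp only: sum.distrib sum_subtractf sum_constant flip: sum_distrib_left total s_def S_def)
      (simp add: sum_subtractf right_diff_distrib flip: S_def s_def)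
  also have "\<dots> = s * (a * (s - 1)) + (1 - a * (s - 1)) * S"
    by (simp add: algebra_simps)
  also have "\<dots> \<ge> s * (a * (s - 1))"
    using A1 by (simp add: a_def s_def S_def sum_nonneg flip: G_def)
  finally have "s * (a * (s - 1)) \<le> (\<Sum>k\<in>G. cost n \<alpha> k z r)" .
  also have "\<dots> \<le> s * max_cost n \<alpha> z r"
    unfolding s_def
    by (rule sum_bounded_above) (auto simp: G_def members_def intro: cost_le_max_cost)
  finally show ?thesis
    using s by (simp add: a_def s_def flip: G_def)
qed

lemma true_profiles_externality_le_1:
  assumes r: "r \<in> true_profiles n m \<alpha>" and i: "i \<in> {1..n}"
  shows "\<alpha> (grp r i) * (real (card (members n r (grp r i))) - 1) \<le> 1"
proof (cases "2 \<le> card (members n r (grp r i))")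
  case True
  have "grp r i \<in> {1..m}"
    using profiles_grp[OF true_profiles_profiles[OF r] i] .
  with r True have "\<alpha> (grp r i) \<le> 1 / (real (card (members n r (grp r i))) - 1)"
    unfolding true_profiles_def by blast
  with True show ?thesis by (simp add: field_simps)
next
  \<comment> \<open>The standing bound is void here: the group consists of \<open>i\<close> alone,
    and the second factor is 0.\<close>
  case False
  have "0 < card (members n r (grp r i))"
    using i by (auto simp: card_gt_0_iff members_def)
  with False have "card (members n r (grp r i)) = 1" by linarith
  then show ?thesis by simp
qed

section \<open>The approximation ratio\<close>

lemma max_cost_mid_M_le:
  assumes n: "1 \<le> n" and \<alpha>: "\<And>j. j \<in> {1..m} \<Longrightarrow> 0 \<le> \<alpha> j"
    and r: "r \<in> true_profiles n m \<alpha>" and z: "z \<in> {0..1}"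
  shows "max_cost n \<alpha> (mid_M n r) r \<le> 5 / 3 * max_cost n \<alpha> z r"
proof (rule max_cost_le[OF n])
  fix i assume i: "i \<in> {1..n}"
  note rp = true_profiles_profiles[OF r]
  define y where "y = mid_M n r"
  define A where "A = \<alpha> (grp r i) * (real (card (members n r (grp r i))) - 1)"
  define c where "c = cost n \<alpha> i y r"
  define t where "t = dist y z"
  define Z where "Z = max_cost n \<alpha> z r"
  obtain p q where pq: "p \<in> {1..n}" "q \<in> {1..n}" "y = (loc r p + loc r q) / 2"
    and lb: "\<And>k. k \<in> {1..n} \<Longrightarrow> loc r p \<le> loc r k"
    and ub: "\<And>k. k \<in> {1..n} \<Longrightarrow> loc r k \<le> loc r q"
    unfolding y_def using mid_M_bounds[OF n] by metis
  define h where "h = (loc r q - loc r p) / 2"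
  have \<alpha>0: "0 \<le> \<alpha> (grp r k)" if "k \<in> {1..n}" for k
    using \<alpha> profiles_grp[OF rp that] by blast
  have dist_le: "dist z (loc r k) \<le> Z" if "k \<in> {1..n}" for k
    using dist_le_cost[of r n m z \<alpha> k] cost_le_max_cost[OF that, of \<alpha> z r] rp z \<alpha>0[OF that]
    unfolding Z_def by linarith
  \<comment> \<open>As \<open>y\<close> is the midpoint, the extreme agent on the side of
    \<open>y\<close> away from \<open>z\<close> is at distance exactly \<open>h + t\<close> from
    \<open>z\<close>.\<close>
  have ht: "h + t \<le> Z"
    using dist_le[OF pq(1)] dist_le[OF pq(2)] unfolding h_def t_def pq(3) dist_real_def
    by (simp add: abs_if field_simps split: if_splits)
  have A1: "A \<le> 1"
    unfolding A_def by (rule true_profiles_externality_le_1[OF r i])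
  have A0: "0 \<le> A"
    unfolding A_def card_members_remove[OF i, symmetric] using \<alpha>0[OF i] by simp
  have AZ: "A \<le> Z"
    using externality_le_max_cost[OF i] A1 unfolding A_def Z_def by blast
  have "dist y (loc r i) \<le> h"
    using lb[OF i] ub[OF i] unfolding h_def pq(3) dist_real_def
    by (simp add: abs_if field_simps)
  then have ch: "c \<le> h + A"
    using cost_le_dist_plus[of i n \<alpha> r y] i \<alpha>0[OF i] unfolding A_def c_def by linarith
  have ct: "c \<le> Z + t * (1 + A)"
    using cost_move_le[of i n \<alpha> r y z] i \<alpha>0[OF i] cost_le_max_cost[OF i, of \<alpha> z r]
    unfolding A_def c_def t_def Z_def by linarith
  \<comment> \<open>The weight \<open>1 + A\<close> gives \<open>h\<close> and \<open>t\<close> the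
    same coefficient, so that \<open>ht\<close> bounds them together.\<close>
  have "(2 + A) * c \<le> (Z + t * (1 + A)) + (1 + A) * (h + A)"
    using ct mult_left_mono[OF ch, of "1 + A"] A0 by (simp add: algebra_simps)
  also have "\<dots> = Z + (1 + A) * (h + t) + (1 + A) * A"
    by (simp add: algebra_simps)
  \<comment> \<open>The last term uses \<open>AZ\<close> and
    \<open>1 + A \<le> 2 / 3 * (2 + A)\<close>, which is equivalent to \<open>A \<le> 1\<close> and
    tight at \<open>A = 1\<close>.\<close>
  also have "\<dots> \<le> Z + (1 + A) * Z + (2 / 3 * (2 + A)) * Z"
    using A0 A1 AZ ht
    by (intro add_mono order_refl mult_left_mono[OF ht] mult_mono[OF _ AZ]) auto
  also have "\<dots> = (2 + A) * (5 / 3 * Z)"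
    by (simp add: algebra_simps)
  finally show "cost n \<alpha> i (mid_M n r) r \<le> 5 / 3 * max_cost n \<alpha> z r"
    using A0 unfolding c_def y_def Z_def by (subst (asm) mult_le_cancel_left_pos) auto
qed

lemma five_thirds_le_ratio: "5 / 3 \<le> (29 + 20 * sqrt 10) / 54"
proof -
  \<comment> \<open>The exact threshold: \<open>29 + 61 = 90 = 54 * 5 / 3\<close>.\<close>
  have "61 / 20 \<le> sqrt 10"
    by (rule real_le_rsqrt) (simp add: power2_eq_square)
  then show ?thesis by simp
qed

lemma approximates_mid_M:
  assumes n: "1 \<le> n" and \<alpha>: "\<And>j. j \<in> {1..m} \<Longrightarrow> 0 \<le> \<alpha> j" and \<rho>: "5 / 3 \<le> \<rho>"
  shows "approximates_max_cost n m \<alpha> \<rho> (mid_M n)"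
  unfolding approximates_max_cost_def
proof
  fix r assume r: "r \<in> true_profiles n m \<alpha>"
  obtain z where z: "z \<in> {0..1}" "opt_max_cost n \<alpha> r = max_cost n \<alpha> z r"
    using opt_max_cost_attained[OF n] by metis
  have one: "1 \<in> {1..n}" using n by simp
  note rp = true_profiles_profiles[OF r]
  \<comment> \<open>Enlarging \<open>5 / 3\<close> to \<open>\<rho>\<close> requires a nonnegative
    maximum cost; agent 1 witnesses this.\<close>
  have "0 \<le> dist z (loc r 1)" by simp
  also have "\<dots> \<le> cost n \<alpha> 1 z r"
    using dist_le_cost[OF rp z(1)] \<alpha>[OF profiles_grp[OF rp one]] .
  also have "\<dots> \<le> max_cost n \<alpha> z r"
    by (rule cost_le_max_cost[OF one])
  finally have "5 / 3 * max_cost n \<alpha> z r \<le> \<rho> * max_cost n \<alpha> z r"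
    by (rule mult_right_mono[OF \<rho>])
  with max_cost_mid_M_le[OF n \<alpha> r z(1)]
  show "max_cost n \<alpha> (mid_M n r) r \<le> \<rho> * opt_max_cost n \<alpha> r"
    unfolding z(2) by linarith
qed

theorem theorem7:
  fixes n m :: nat and \<alpha> :: "nat \<Rightarrow> real"
  assumes "n \<ge> 1"
    and "\<And>j. j \<in> {1..m} \<Longrightarrow> \<alpha> j \<ge> 0"
  shows "mechanism n m (mid_M n)
    \<and> strategyproof_private_groups n m \<alpha> (mid_M n)
    \<and> approximates_max_cost n m \<alpha> ((29 + 20 * sqrt 10) / 54) (mid_M n)"
proof (intro conjI)
  show "approximates_max_cost n m \<alpha> ((29 + 20 * sqrt 10) / 54) (mid_M n)"
    using assms five_thirds_le_ratio by (rule approximates_mid_M)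
qed (rule mechanism_mid_M[OF assms(1)] strategyproof_mid_M)+

end
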